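(* There exist $C>0$ and $\eta,\kappa_0\in(0,1)$ such that, for $\kappa\in(0,\kappa_0)$ and $\rho\in(0,1]$, $$\big|\lambda_{\max}(\kappa,\rho)-1\big|\le C\kappa^\eta.$$
   Context: For $(\kappa,\rho)\in(0,1]\times(0,\infty)$ with $\rho^2\kappa\le1$, $\mathrm{ABMN}(\kappa,\rho)$ is the set of sequences $(a_i,b_i,m_i,n_i)_{i\in\mathbb{Z}}$ with values in $(0,\infty)^2\times\mathbb{R}^2$ satisfying, for every $i\in\mathbb{Z}$, $$2(a_i^\rho+b_i^\rho)(m_i+a_i)=\big(a_i^\rho(1-\kappa)+b_i^\rho(1+\kappa)\big)m_{i-1}+\big(a_i^\rho(1+\kappa)+b_i^\rho(1-\kappa)\big)m_{i+1},$$ $$2(a_i^\rho+b_i^\rho)(n_i+b_i)=\big(a_i^\rho(1-\kappa)+b_i^\rho(1+\kappa)\big)n_{i-1}+\big(a_i^\rho(1+\kappa)+b_i^\rho(1-\kappa)\big)n_{i+1},$$ $$(a_i^\rho+b_i^\rho)^2=\rho\kappa\,a_i^{\rho-1}b_i^\rho\,(m_{i+1}-m_{i-1}),\qquad (a_i^\rho+b_i^\rho)^2=\rho\kappa\,a_i^{\rho}b_i^{\rho-1}\,(n_{i-1}-n_{i+1}).$$ For every element, the limits $m_{\pm\infty}=\lim_{k\to\infty}m_{\pm k}$ and $n_{\pm\infty}=\lim_{k\to\infty}n_{\pm k}$ exist and are finite, with $m_{-\infty}<m_\infty$ and $n_\infty<n_{-\infty}$. Define $$\lambda_{\max}(\kappa,\rho)=\sup\Big\{\frac{n_{-\infty}-n_\infty}{m_\infty-m_{-\infty}}:(a,b,m,n)\in\mathrm{ABMN}(\kappa,\rho)\Big\}.$$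 *)

theory Defs
  imports Complex_Main "HOL-Library.Extended_Real"
begin

text \<open>
  The paper considers parameters with \<open>0 < \<kappa> \<le> 1\<close>, \<open>0 < \<rho>\<close> and \<open>\<rho>\<^sup>2 * \<kappa> \<le> 1\<close>; the definitions
  below make sense for all real parameters, and the range is imposed where they are used.
\<close>

definition ABMN ::
  "real \<Rightarrow> real \<Rightarrow> ((int \<Rightarrow> real) \<times> (int \<Rightarrow> real) \<times> (int \<Rightarrow> real) \<times> (int \<Rightarrow> real)) set" where
  "ABMN \<kappa> \<rho> = {(a, b, m, n). \<forall>i.
     a i > 0 \<and> b i > 0 \<and>
     2 * (a i powr \<rho> + b i powr \<rho>) * (m i + a i)
       = (a i powr \<rho> * (1 - \<kappa>) + b i powr \<rho> * (1 + \<kappa>)) * m (i - 1)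
       + (a i powr \<rho> * (1 + \<kappa>) + b i powr \<rho> * (1 - \<kappa>)) * m (i + 1) \<and>
     2 * (a i powr \<rho> + b i powr \<rho>) * (n i + b i)
       = (a i powr \<rho> * (1 - \<kappa>) + b i powr \<rho> * (1 + \<kappa>)) * n (i - 1)
       + (a i powr \<rho> * (1 + \<kappa>) + b i powr \<rho> * (1 - \<kappa>)) * n (i + 1) \<and>
     (a i powr \<rho> + b i powr \<rho>)\<^sup>2
       = \<rho> * \<kappa> * a i powr (\<rho> - 1) * b i powr \<rho> * (m (i + 1) - m (i - 1)) \<and>
     (a i powr \<rho> + b i powr \<rho>)\<^sup>2
       = \<rho> * \<kappa> * a i powr \<rho> * b i powr (\<rho> - 1) * (n (i - 1) - n (i + 1))}"

definition lim_pos :: "(int \<Rightarrow> real) \<Rightarrow> real" where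
  "lim_pos x = lim (\<lambda>k::nat. x (int k))"

definition lim_neg :: "(int \<Rightarrow> real) \<Rightarrow> real" where
  "lim_neg x = lim (\<lambda>k::nat. x (- int k))"

text \<open>
  The supremum is taken in the extended reals, so that it is meaningful without knowing
  beforehand that the set of ratios is nonempty and bounded above.
\<close>

definition lambda_max :: "real \<Rightarrow> real \<Rightarrow> ereal" where
  "lambda_max \<kappa> \<rho> =
     (SUP (a, b, m, n) \<in> ABMN \<kappa> \<rho>.
        ereal ((lim_neg n - lim_pos n) / (lim_pos m - lim_neg m)))"

end

theory Submission
  imports Defs "HOL-Analysis.Infinite_Sum"
begin

text \<open>
  Pass to the increments \<open>x i = m i - m (i - 1)\<close> and \<open>y i = n (i - 1) - n i\<close> and to the stake ratio
  \<open>\<beta> i = b i / a i\<close>. The equations say that \<open>\<beta>\<close> follows a one-dimensional increasing recursion with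
  \<open>\<beta> \<rightarrow> \<infinity>\<close> at \<open>-\<infinity>\<close> and \<open>\<beta> \<rightarrow> 0\<close> at \<open>\<infinity>\<close>, and that \<open>x (i + 1) / x i\<close> and \<open>y (i + 1) / y i\<close> are
  increasing functions of \<open>\<beta> i\<close> within a factor \<open>1 + O(\<kappa>)\<close> of one. Hence, after a shift, any two solutions
  have interlaced \<open>\<beta>\<close>, so that their increments agree termwise up to scaling and a factor \<open>1 + O(\<kappa>)\<close>.
  Reversing \<open>i\<close> and exchanging the two players maps solutions to solutions and inverts the ratio
  \<open>(\<Sum>y) / (\<Sum>x)\<close> whose supremum is \<open>\<lambda>\<^sub>m\<^sub>a\<^sub>x\<close>; comparing a solution with its own reversal shows that
  this ratio is \<open>1 + O(\<kappa>)\<close>, uniformly in \<open>\<rho>\<close>.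
\<close>

section \<open>The drift coefficients\<close>

text \<open>
  If \<open>2 * d\<close> is the increment of \<open>m\<close> over two steps around a site with stake ratio \<open>\<beta>\<close>, its two halves are
  \<open>d * (1 \<plusminus> \<kappa> * cx \<rho> \<beta>)\<close>; \<open>cy\<close> plays the same role for the decrements of \<open>n\<close>, which sum to \<open>2 * \<beta> * d\<close>.
\<close>

definition share :: "real \<Rightarrow> real \<Rightarrow> real" where
  "share \<rho> \<beta> = \<beta> powr \<rho> / (1 + \<beta> powr \<rho>)"

definition cx :: "real \<Rightarrow> real \<Rightarrow> real" where
  "cx \<rho> \<beta> = 1 - 2 * share \<rho> \<beta> - 2 * \<rho> * share \<rho> \<beta> * (1 - share \<rho> \<beta>)"

definition cy :: "real \<Rightarrow> real \<Rightarrow> real" where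
  "cy \<rho> \<beta> = 1 - 2 * share \<rho> \<beta> + 2 * \<rho> * share \<rho> \<beta> * (1 - share \<rho> \<beta>)"

lemma share_bounds: "\<beta> > 0 \<Longrightarrow> 0 < share \<rho> \<beta>" "\<beta> > 0 \<Longrightarrow> share \<rho> \<beta> < 1"
  by (simp_all add: share_def add_pos_pos)

lemma share_inverse: "\<beta> > 0 \<Longrightarrow> share \<rho> (1 / \<beta>) = 1 - share \<rho> \<beta>"
proof -
  assume "\<beta> > 0"
  then obtain u where u: "\<beta> powr \<rho> = u" "u > 0" by simp
  then show ?thesis
    using \<open>\<beta> > 0\<close> by (simp add: share_def powr_divide u(1) field_simps)
qed

lemma share_mono:
  assumes "0 < \<beta>" "\<beta> \<le> \<gamma>" "0 < \<rho>"
  shows "share \<rho> \<beta> \<le> share \<rho> \<gamma>"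
proof -
  have "0 < \<beta> powr \<rho>" "\<beta> powr \<rho> \<le> \<gamma> powr \<rho>"
    using assms by (auto intro: powr_mono2)
  then obtain u v where "\<beta> powr \<rho> = u" "\<gamma> powr \<rho> = v" "0 < u" "u \<le> v"
    by blast
  then show ?thesis
    by (simp add: share_def field_simps)
qed

text \<open>Inverting \<open>\<beta>\<close> exchanges \<open>s\<close> and \<open>1 - s\<close>,
  which flips \<open>1 - 2 * s\<close> and fixes \<open>s * (1 - s)\<close>. This is the algebra
  behind \<open>orbit_reflect\<close>.\<close>

lemma cx_inverse: "\<beta> > 0 \<Longrightarrow> cx \<rho> (1 / \<beta>) = - cy \<rho> \<beta>"
  and cy_inverse: "\<beta> > 0 \<Longrightarrow> cy \<rho> (1 / \<beta>) = - cx \<rho> \<beta>"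
  by (simp_all add: cx_def cy_def share_inverse algebra_simps)

text \<open>The differences factor as \<open>2 * (t - s) * (1 + \<rho> * (1 - s - t))\<close> for
  \<open>cx\<close>, and with a minus sign before \<open>\<rho>\<close> for \<open>cy\<close>. Both
  are nonnegative because \<open>\<rho> \<le> 1\<close>.\<close>

lemma cx_cy_antimono:
  assumes "0 < \<beta>" "\<beta> \<le> \<gamma>" "0 < \<rho>" "\<rho> \<le> 1"
  shows "cx \<rho> \<gamma> \<le> cx \<rho> \<beta>" "cy \<rho> \<gamma> \<le> cy \<rho> \<beta>"
proof -
  define s t where "s = share \<rho> \<beta>" and "t = share \<rho> \<gamma>"
  have st: "0 < s" "s \<le> t" "t < 1"
    using share_bounds share_mono assms unfolding s_def t_def by auto
  have "\<bar>\<rho> * (1 - s - t)\<bar> \<le> 1 * 1"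
    unfolding abs_mult using st assms by (intro mult_mono) auto
  then have "0 \<le> (t - s) * (1 + \<rho> * (1 - s - t))" "0 \<le> (t - s) * (1 - \<rho> * (1 - s - t))"
    using st by auto
  then show "cx \<rho> \<gamma> \<le> cx \<rho> \<beta>" "cy \<rho> \<gamma> \<le> cy \<rho> \<beta>"
    unfolding cx_def cy_def s_def[symmetric] t_def[symmetric] by (simp_all add: algebra_simps)
qed

lemma cx_less_cy:
  assumes "0 < \<beta>" "0 < \<rho>"
  shows "cx \<rho> \<beta> < cy \<rho> \<beta>"
proof -
  have "0 < \<rho> * (share \<rho> \<beta> * (1 - share \<rho> \<beta>))"
    using assms share_bounds[of \<beta> \<rho>] by simp
  then show ?thesis by (simp add: cx_def cy_def algebra_simps)
qed

lemma share_mult_le: "\<beta> > 0 \<Longrightarrow> 0 < \<rho> \<Longrightarrow> \<rho> \<le> 1 \<Longrightarrow>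
  0 \<le> \<rho> * (share \<rho> \<beta> * (1 - share \<rho> \<beta>)) \<and> \<rho> * (share \<rho> \<beta> * (1 - share \<rho> \<beta>)) \<le> 1/4"
proof -
  assume a: "\<beta> > 0" "0 < \<rho>" "\<rho> \<le> 1"
  let ?s = "share \<rho> \<beta>"
  have "0 \<le> ?s * (1 - ?s)" using share_bounds[OF a(1), of \<rho>] by simp
  moreover have "?s * (1 - ?s) \<le> 1/4"
    using zero_le_power2[of "?s - 1/2"] by (simp add: power2_eq_square algebra_simps)
  ultimately show ?thesis
    using a mult_mono[of \<rho> 1 "?s * (1 - ?s)" "1/4"] by simp
qed

text \<open>The linear part is at most 1 in absolute value and the quadratic part at most
  \<open>2 * (1/4)\<close>.\<close>

lemma abs_cx_le: "\<beta> > 0 \<Longrightarrow> 0 < \<rho> \<Longrightarrow> \<rho> \<le> 1 \<Longrightarrow> \<bar>cx \<rho> \<beta>\<bar> \<le> 3/2"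
  and abs_cy_le: "\<beta> > 0 \<Longrightarrow> 0 < \<rho> \<Longrightarrow> \<rho> \<le> 1 \<Longrightarrow> \<bar>cy \<rho> \<beta>\<bar> \<le> 3/2"
  using share_mult_le[of \<beta> \<rho>] share_bounds[of \<beta> \<rho>] unfolding cx_def cy_def mult.assoc by linarith+

lemma continuous_on_cx [continuous_intros]: "continuous_on {0<..} (cx \<rho>)"
  and continuous_on_cy [continuous_intros]: "continuous_on {0<..} (cy \<rho>)"
proof -
  have "1 + \<beta> powr \<rho> \<noteq> 0" for \<beta> :: real
    using powr_ge_zero[of \<beta> \<rho>] by linarith
  then have "continuous_on {0<..} (share \<rho>)"
    unfolding share_def[abs_def] by (intro continuous_intros) auto
  then show "continuous_on {0<..} (cx \<rho>)" "continuous_on {0<..} (cy \<rho>)"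
    unfolding cx_def[abs_def] cy_def[abs_def] by (auto intro!: continuous_intros)
qed

section \<open>Sequences indexed by the integers\<close>

lemma ratio_summable_on_atLeast:
  fixes z :: "int \<Rightarrow> real"
  assumes "\<And>i. 0 < z i" "c < 1" "\<And>i. N \<le> i \<Longrightarrow> z (i + 1) \<le> c * z i"
  shows "z summable_on {N..}"
proof -
  have "summable (\<lambda>k. z (N + int k))"
  proof (rule summable_ratio_test[of c 0])
    fix k :: nat
    show "norm (z (N + int (Suc k))) \<le> c * norm (z (N + int k))"
      using assms(3)[of "N + int k"] assms(1)[THEN less_imp_le] by (simp add: ac_simps)
  qed (rule assms(2))
  then have "(\<lambda>k. z (N + int k)) summable_on UNIV"
    using assms(1)[THEN less_imp_le] by (intro norm_summable_imp_summable_on) simp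
  moreover have "bij_betw (\<lambda>k. N + int k) UNIV {N..}"
    by (rule bij_betwI[where g = "\<lambda>i. nat (i - N)"]) auto
  ultimately show ?thesis
    using summable_on_reindex_bij_betw by blast
qed

text \<open>Splitting the sum into indices at least 1 and at most 0 makes both halves telescope away
  from \<open>m 0\<close>.\<close>

lemma telescoping_limits:
  fixes m x :: "int \<Rightarrow> real"
  assumes "x summable_on UNIV" "\<And>i. m i - m (i - 1) = x i"
  obtains P Q where "(\<lambda>k. m (int k)) \<longlonglongrightarrow> P" "(\<lambda>k. m (- int k)) \<longlonglongrightarrow> Q" "P - Q = infsum x UNIV"
proof -
  have summ: "x summable_on {1..}" "x summable_on {..0}"
    using summable_on_subset[OF assms(1)] by auto
  have "bij_betw (\<lambda>k. int k + 1) UNIV {1..}"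
    by (rule bij_betwI[where g = "\<lambda>i. nat (i - 1)"]) auto
  then have "((\<lambda>k. x (int k + 1)) has_sum infsum x {1..}) UNIV"
    using summ by (subst has_sum_reindex_bij_betw) auto
  moreover have "bij_betw (\<lambda>k. - int k) UNIV {..0}"
    by (rule bij_betwI[where g = "\<lambda>i. nat (- i)"]) auto
  then have "((\<lambda>k. x (- int k)) has_sum infsum x {..0}) UNIV"
    using summ by (subst has_sum_reindex_bij_betw) auto
  ultimately have lim: "(\<lambda>n. \<Sum>k<n. x (int k + 1)) \<longlonglongrightarrow> infsum x {1..}" "(\<lambda>n. \<Sum>k<n. x (- int k)) \<longlonglongrightarrow> infsum x {..0}"
    by (auto dest!: has_sum_imp_sums simp: sums_def)
  have right: "m (int n) = m 0 + (\<Sum>k<n. x (int k + 1))" for n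
  proof (induction n)
    case (Suc n)
    then show ?case using assms(2)[of "int n + 1"] by (simp add: add.commute)
  qed simp
  have left: "m (- int n) = m 0 - (\<Sum>k<n. x (- int k))" for n
  proof (induction n)
    case (Suc n)
    have "m (- int (Suc n)) = m (- int n - 1)" by (rule arg_cong[of _ _ m]) simp
    then show ?case using Suc assms(2)[of "- int n"] by simp
  qed simp
  have "infsum x UNIV = infsum x {1..} + infsum x {..0}"
    by (subst infsum_Un_disjoint[symmetric]) (auto simp: summ intro: arg_cong[where f = "infsum x"])
  moreover have "(\<lambda>k. m (int k)) \<longlonglongrightarrow> m 0 + infsum x {1..}" "(\<lambda>k. m (- int k)) \<longlonglongrightarrow> m 0 - infsum x {..0}"
    unfolding right left by (intro tendsto_intros lim)+
  ultimately show ?thesis using that by force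
qed

lemma antidifference:
  fixes x :: "int \<Rightarrow> 'a::ab_group_add"
  obtains m where "\<And>i. m i - m (i - 1) = x i"
proof
  fix i :: int
  \<comment> \<open>At every \<open>i\<close> at least one of the two ranges is empty, so this is
    the signed sum from 0 to \<open>i\<close>.\<close>
  let ?m = "\<lambda>i. (\<Sum>j\<in>{0<..i}. x j) - (\<Sum>j\<in>{i<..0}. x j)"
  show "?m i - ?m (i - 1) = x i"
  proof (cases "0 < i")
    case True
    then have "{0<..i} = insert i {0<..i - 1}" "{i<..0} = {}" "{i - 1<..0} = {}" by auto
    then show ?thesis by simp
  next
    case False
    then have "{i - 1<..0} = insert i {i<..0}" "{0<..i} = {}" "{0<..i - 1} = {}" by auto
    then show ?thesis by simp
  qed
qed

text \<open>For \<open>i \<ge> 0\<close>, \<open>R' i \<le> R i\<close> keeps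
  \<open>z' i / z' 0\<close> below \<open>z i / z 0\<close>, while
  \<open>R (i + 1) \<le> R' i\<close> keeps it above \<open>z (i + 1) / z 1\<close>. Undoing that
  shift by one costs a factor \<open>q\<close> at each end, hence \<open>q\<^sup>2\<close> uniformly
  in \<open>i\<close>.\<close>

lemma interlaced_bounds:
  fixes z z' R R' :: "int \<Rightarrow> real"
  assumes pos: "\<And>i. 0 < z i" "\<And>i. 0 < z' i"
    and z: "\<And>i. z (i + 1) = R i * z i" and z': "\<And>i. z' (i + 1) = R' i * z' i"
    and inter: "\<And>i. R (i + 1) \<le> R' i" "\<And>i. R' i \<le> R i"
    and R: "\<And>i. q \<le> R i" "\<And>i. q * R i \<le> 1" "\<And>i. 0 < R' i"
    and q: "0 < q" "q \<le> 1"
  shows "q\<^sup>2 * (z' 0 * z i) \<le> z' i * z 0 \<and> q\<^sup>2 * (z' i * z 0) \<le> z' 0 * z i"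
proof -
  have Rpos: "0 < R i" for i using inter(2) R(3) less_le_trans by blast
  note p = less_imp_le[OF pos(1)] less_imp_le[OF pos(2)] less_imp_le[OF R(3)] less_imp_le[OF Rpos]
  have up: "q * z i \<le> z (i + 1)" for i
    using mult_right_mono[OF R(1)[of i] p(1)[of i]] by (simp add: z)
  have down: "q * z (i + 1) \<le> z i" for i
    using mult_right_mono[OF R(2)[of i] p(1)[of i]] by (simp add: z mult.assoc)
  have q2: "q\<^sup>2 * r \<le> r" "q\<^sup>2 * r = q * (q * r)" if "0 \<le> r" for r
  proof -
    have "q\<^sup>2 \<le> 1" using q by (simp add: power_le_one)
    then show "q\<^sup>2 * r \<le> r" "q\<^sup>2 * r = q * (q * r)"
      using mult_right_mono[of "q\<^sup>2" 1 r] that by (auto simp: power2_eq_square)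
  qed
  show ?thesis
  proof (cases "0 \<le> i")
    case True
    have "z' i * z 0 \<le> z' 0 * z i \<and> z' 0 * z (i + 1) \<le> z' i * z 1"
      using True
    proof (induction i rule: int_ge_induct)
      case (step i)
      have bounds: "R' i * (z' i * z 0) \<le> R i * (z' 0 * z i)" "R (i + 1) * (z' 0 * z (i + 1)) \<le> R' i * (z' i * z 1)"
        using step.IH inter p by (auto intro: mult_mono[OF _ conjunct1] mult_mono[OF _ conjunct2])
      have "z' (i + 1) * z 0 \<le> z' 0 * z (i + 1)"
        unfolding z[of i] z'[of i] using bounds(1) by (simp only: mult_ac)
      moreover have "z' 0 * z (i + 1 + 1) \<le> z' (i + 1) * z 1"
        unfolding z[of "i + 1"] z'[of i] using bounds(2) by (simp only: mult_ac)
      ultimately show ?case by blast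
    qed simp
    moreover have "q * (q * (z' 0 * z i)) \<le> q * (z' 0 * z (i + 1))"
      using mult_left_mono[OF mult_left_mono[OF up[of i] p(2)[of 0]] less_imp_le[OF q(1)]] by (simp only: mult_ac)
    moreover have "q * (z' i * z 1) \<le> z' i * z 0"
      using mult_left_mono[OF down[of 0] p(2)[of i]] by (simp add: mult_ac)
    ultimately show ?thesis
      using q2[of "z' 0 * z i"] q2[of "z' i * z 0"] mult_nonneg_nonneg[OF p(2,1)] less_imp_le[OF q(1)]
        mult_left_mono[of "z' 0 * z (i + 1)" "z' i * z 1" q] by force
  next
    case False
    then have "i \<le> 0" by simp
    \<comment> \<open>To the left of 0 one divides by the ratios, so both inequalities
      reverse.\<close>
    then have "z' 0 * z i \<le> z' i * z 0 \<and> z' i * z 1 \<le> z' 0 * z (i + 1)"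
    proof (induction i rule: int_le_induct)
      case (step i)
      define j where "j = i - 1"
      have i: "i = j + 1" by (simp add: j_def)
      have IH: "z' 0 * z (j + 1) \<le> z' (j + 1) * z 0" "z' (j + 1) * z 1 \<le> z' 0 * z (j + 1 + 1)"
        using step.IH unfolding i by blast+
      have "R j * (z' 0 * z j) \<le> R' j * (z' j * z 0)"
        using IH(1) unfolding z[of j] z'[of j] by (simp only: mult_ac)
      moreover have "R' j * (z' j * z 1) \<le> R (j + 1) * (z' 0 * z (j + 1))"
        using IH(2) unfolding z[of "j + 1"] z'[of j] by (simp only: mult_ac)
      moreover have "R' j * (z' j * z 0) \<le> R j * (z' j * z 0)"
        "R (j + 1) * (z' 0 * z (j + 1)) \<le> R' j * (z' 0 * z (j + 1))"
        using inter p by (intro mult_right_mono; simp)+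
      ultimately have "R j * (z' 0 * z j) \<le> R j * (z' j * z 0)" "R' j * (z' j * z 1) \<le> R' j * (z' 0 * z (j + 1))"
        by linarith+
      then show ?case using Rpos[of j] R(3)[of j] by (simp add: j_def)
    qed simp
    moreover have "q * (q * (z' i * z 0)) \<le> q * (z' i * z 1)"
      using mult_left_mono[OF mult_left_mono[OF up[of 0] p(2)[of i]] less_imp_le[OF q(1)]] by (simp add: mult_ac)
    moreover have "q * (z' 0 * z (i + 1)) \<le> z' 0 * z i"
      using mult_left_mono[OF down[of i] p(2)[of 0]] by (simp only: mult_ac)
    ultimately show ?thesis
      using q2[of "z' 0 * z i"] q2[of "z' i * z 0"] mult_nonneg_nonneg[OF p(2,1)] less_imp_le[OF q(1)]
        mult_left_mono[of "z' i * z 1" "z' 0 * z (i + 1)" q] by force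
  qed
qed

section \<open>Orbits of the stake ratio\<close>

text \<open>The threshold \<open>1/12\<close> keeps every factor
  \<open>1 \<plusminus> \<kappa> * cx\<close> and \<open>1 \<plusminus> \<kappa> * cy\<close>
  between 7/8 and 9/8, and lets the final constant be 12.\<close>

locale small_noise =
  fixes \<kappa> \<rho> :: real
  assumes kappa_pos: "0 < \<kappa>" and kappa_less: "\<kappa> < 1/12"
    and rho_pos: "0 < \<rho>" and rho_le: "\<rho> \<le> 1"
begin

text \<open>Each \<open>x i\<close> and \<open>y i\<close> is described twice, as the later half at
  site \<open>i - 1\<close> and as the earlier half at site \<open>i\<close>. Their agreement
  encodes the recursion.\<close>

definition orbit ::
  "(int \<Rightarrow> real) \<Rightarrow> (int \<Rightarrow> real) \<Rightarrow> (int \<Rightarrow> real) \<Rightarrow> (int \<Rightarrow> real) \<Rightarrow> bool" where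
  "orbit \<beta> d x y \<longleftrightarrow> (\<forall>i. 0 < \<beta> i \<and> 0 < d i \<and>
     x i = d i * (1 + \<kappa> * cx \<rho> (\<beta> i)) \<and> x (i + 1) = d i * (1 - \<kappa> * cx \<rho> (\<beta> i)) \<and>
     y i = \<beta> i * d i * (1 + \<kappa> * cy \<rho> (\<beta> i)) \<and> y (i + 1) = \<beta> i * d i * (1 - \<kappa> * cy \<rho> (\<beta> i)))"

text \<open>
  The values of \<open>y / x\<close> just before and just after a site with stake ratio \<open>\<beta>\<close>; equating them at
  neighbouring sites gives the recursion for \<open>\<beta>\<close>.
\<close>

definition slope_before :: "real \<Rightarrow> real" where
  "slope_before \<beta> = \<beta> * (1 + \<kappa> * cy \<rho> \<beta>) / (1 + \<kappa> * cx \<rho> \<beta>)"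

definition slope_after :: "real \<Rightarrow> real" where
  "slope_after \<beta> = \<beta> * (1 - \<kappa> * cy \<rho> \<beta>) / (1 - \<kappa> * cx \<rho> \<beta>)"

section \<open>Size of the drift factors and monotonicity of the slopes\<close>

lemma abs_kcx_le: "\<beta> > 0 \<Longrightarrow> \<bar>\<kappa> * cx \<rho> \<beta>\<bar> \<le> 3/2 * \<kappa>"
  and abs_kcy_le: "\<beta> > 0 \<Longrightarrow> \<bar>\<kappa> * cy \<rho> \<beta>\<bar> \<le> 3/2 * \<kappa>"
  using abs_cx_le[of \<beta> \<rho>] abs_cy_le[of \<beta> \<rho>] kappa_pos rho_pos rho_le by (simp_all add: abs_mult)

lemma factor_bounds:
  assumes "\<beta> > 0"
  shows "7/8 < 1 + \<kappa> * cx \<rho> \<beta>" "7/8 < 1 - \<kappa> * cx \<rho> \<beta>"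
    "7/8 < 1 + \<kappa> * cy \<rho> \<beta>" "7/8 < 1 - \<kappa> * cy \<rho> \<beta>"
    "1 + \<kappa> * cx \<rho> \<beta> < 9/8" "1 - \<kappa> * cx \<rho> \<beta> < 9/8"
    "1 + \<kappa> * cy \<rho> \<beta> < 9/8" "1 - \<kappa> * cy \<rho> \<beta> < 9/8"
  using abs_kcx_le[OF assms] abs_kcy_le[OF assms] kappa_less by linarith+

lemma slope_inverse: "\<beta> > 0 \<Longrightarrow> slope_after (1 / \<beta>) = 1 / slope_before \<beta>"
  using factor_bounds[of \<beta>] by (simp add: slope_after_def slope_before_def cx_inverse cy_inverse)

text \<open>
  In the variable \<open>w = \<beta> powr \<rho>\<close> the slope is \<open>\<beta> powr (1 - \<rho>)\<close>, which is nondecreasing because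
  \<open>\<rho> \<le> 1\<close>, times the rational function \<open>w * (A w + \<epsilon> * w) / (A w - \<epsilon> * w)\<close>.
\<close>

lemma slope_before_strict_mono:
  assumes "0 < \<beta>" "\<beta> < \<gamma>"
  shows "slope_before \<beta> < slope_before \<gamma>"
proof -
  define v w where "v = \<beta> powr \<rho>" and "w = \<gamma> powr \<rho>"
  define \<epsilon> where "\<epsilon> = 2 * \<rho> * \<kappa>"
  define A where "A = (\<lambda>w. (1 + \<kappa>) + 2 * w + (1 - \<kappa>) * w\<^sup>2)"
  define K L where "K = (A v + \<epsilon> * v) / (A v - \<epsilon> * v)" and "L = (A w + \<epsilon> * w) / (A w - \<epsilon> * w)"
  have v: "0 < v" "v < w"
    using assms rho_pos by (auto simp: v_def w_def powr_less_mono2)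
  have \<epsilon>: "0 < \<epsilon>" "\<epsilon> \<le> 1"
    using kappa_pos kappa_less rho_pos rho_le mult_mono[of \<rho> 1 \<kappa> "1/2"] by (auto simp: \<epsilon>_def)
  have form: "slope_before \<alpha> = \<alpha> * (A (\<alpha> powr \<rho>) + \<epsilon> * \<alpha> powr \<rho>) / (A (\<alpha> powr \<rho>) - \<epsilon> * \<alpha> powr \<rho>)"
    and pos: "0 < A (\<alpha> powr \<rho>) - \<epsilon> * \<alpha> powr \<rho>" if "\<alpha> > 0" for \<alpha>
  proof -
    define u where "u = \<alpha> powr \<rho>"
    have u: "u > 0" using that by (simp add: u_def)
    have s: "share \<rho> \<alpha> = u / (1 + u)" by (simp add: share_def u_def)
    have 1: "(1 + \<kappa> * cy \<rho> \<alpha>) = (A u + \<epsilon> * u) / (1 + u)\<^sup>2"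
      and 2: "(1 + \<kappa> * cx \<rho> \<alpha>) = (A u - \<epsilon> * u) / (1 + u)\<^sup>2"
    proof -
      have "(1 + u)\<^sup>2 \<noteq> 0" using u by simp
      moreover have t: "share \<rho> \<alpha> * (1 + u) = u" using u by (simp add: s)
      \<comment> \<open>The sign of \<open>r\<close> selects the coefficient: \<open>\<rho>\<close>
        gives \<open>cy\<close> and \<open>- \<rho>\<close> gives \<open>cx\<close>.\<close>
      have poly: "(1 + \<kappa> * (1 - 2 * t + 2 * r * t * (1 - t))) * (1 + u)\<^sup>2
          = (1 + \<kappa>) + 2 * u + (1 - \<kappa>) * u\<^sup>2 + 2 * r * \<kappa> * u"
        if t: "t * (1 + u) = u" for t r :: real
      proof -
        have t': "(1 - t) * (1 + u) = 1" using t by (simp add: algebra_simps)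
        have "(1 + \<kappa> * (1 - 2 * t + 2 * r * t * (1 - t))) * (1 + u)\<^sup>2
          = (1 + u)\<^sup>2 + \<kappa> * ((1 + u)\<^sup>2 - 2 * (t * (1 + u)) * (1 + u)
            + 2 * r * (t * (1 + u)) * ((1 - t) * (1 + u)))"
          by (simp add: algebra_simps power2_eq_square)
        also have "\<dots> = (1 + \<kappa>) + 2 * u + (1 - \<kappa>) * u\<^sup>2 + 2 * r * \<kappa> * u"
          unfolding t t' by (simp add: algebra_simps power2_eq_square)
        finally show ?thesis .
      qed
      have "(1 + \<kappa> * cy \<rho> \<alpha>) * (1 + u)\<^sup>2 = A u + \<epsilon> * u"
        using poly[OF t, of \<rho>] by (simp add: cy_def A_def \<epsilon>_def)
      moreover have "(1 + \<kappa> * cx \<rho> \<alpha>) * (1 + u)\<^sup>2 = A u - \<epsilon> * u"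
        using poly[OF t, of "- \<rho>"] by (simp add: cx_def A_def \<epsilon>_def)
      ultimately show "(1 + \<kappa> * cy \<rho> \<alpha>) = (A u + \<epsilon> * u) / (1 + u)\<^sup>2"
        "(1 + \<kappa> * cx \<rho> \<alpha>) = (A u - \<epsilon> * u) / (1 + u)\<^sup>2"
        by (simp_all add: nonzero_eq_divide_eq)
    qed
    show "slope_before \<alpha> = \<alpha> * (A (\<alpha> powr \<rho>) + \<epsilon> * \<alpha> powr \<rho>) / (A (\<alpha> powr \<rho>) - \<epsilon> * \<alpha> powr \<rho>)"
    proof -
      have "slope_before \<alpha> = \<alpha> * ((A u + \<epsilon> * u) / (1 + u)\<^sup>2) / ((A u - \<epsilon> * u) / (1 + u)\<^sup>2)"
        unfolding slope_before_def 1 2 ..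
      then have "slope_before \<alpha> = \<alpha> * (A u + \<epsilon> * u) / (A u - \<epsilon> * u)" using u by simp
      then show ?thesis by (simp only: u_def)
    qed
    show "0 < A (\<alpha> powr \<rho>) - \<epsilon> * \<alpha> powr \<rho>"
    proof -
      have "0 < (A u - \<epsilon> * u) / (1 + u)\<^sup>2"
        unfolding 2[symmetric] using factor_bounds(1)[OF that] by linarith
      then show ?thesis using u by (simp add: zero_less_divide_iff u_def[symmetric])
    qed
  qed
  have D: "0 < A v - \<epsilon> * v" "0 < A w - \<epsilon> * w"
    using pos[of \<beta>] pos[of \<gamma>] assms by (auto simp: v_def w_def)
  \<comment> \<open>The possibly negative contributions are \<open>\<epsilon> * Z\<close> and
    \<open>\<epsilon>\<^sup>2 * (v * w)\<close>. As \<open>\<epsilon> \<le> 1\<close>, the terms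
    \<open>2 * Z\<close> and \<open>4 * (v * w)\<close> of \<open>A v * A w\<close> absorb
    them.\<close>
  have "0 < A v * A w + \<epsilon> * (v + w) * ((1 + \<kappa>) - (1 - \<kappa>) * (v * w)) - \<epsilon>\<^sup>2 * (v * w)"
  proof -
    define Z where "Z = (v + w) * ((1 - \<kappa>) * (v * w))"
    have "0 \<le> Z" using v kappa_less by (simp add: Z_def)
    moreover have "(2 * v + (1 - \<kappa>) * v\<^sup>2) * (2 * w + (1 - \<kappa>) * w\<^sup>2) \<le> A v * A w"
      using v kappa_pos kappa_less by (intro mult_mono) (auto simp: A_def)
    moreover have "(2 * v + (1 - \<kappa>) * v\<^sup>2) * (2 * w + (1 - \<kappa>) * w\<^sup>2)
        = 4 * (v * w) + 2 * Z + (1 - \<kappa>)\<^sup>2 * v\<^sup>2 * w\<^sup>2"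
      unfolding Z_def by algebra
    moreover have "0 \<le> (1 - \<kappa>)\<^sup>2 * v\<^sup>2 * w\<^sup>2" by simp
    moreover have "\<epsilon> * Z \<le> 1 * Z"
      using \<epsilon> \<open>0 \<le> Z\<close> by (intro mult_right_mono)
    moreover have "\<epsilon>\<^sup>2 * (v * w) \<le> 1 * (v * w)"
      using \<epsilon> v by (intro mult_right_mono) (auto simp: power_le_one)
    moreover have "0 < v * w" using v by simp
    moreover have "0 \<le> \<epsilon> * (v + w) * (1 + \<kappa>)" using v \<epsilon> kappa_pos by simp
    ultimately have "0 < A v * A w + \<epsilon> * (v + w) * (1 + \<kappa>) - \<epsilon> * Z - \<epsilon>\<^sup>2 * (v * w)"
      by argo
    then show ?thesis by (simp add: Z_def algebra_simps)
  qed
  then have "0 < (w - v) * (A v * A w + \<epsilon> * (v + w) * ((1 + \<kappa>) - (1 - \<kappa>) * (v * w)) - \<epsilon>\<^sup>2 * (v * w))"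
    using v by simp
  \<comment> \<open>This is the cross-multiplied difference of \<open>w * L\<close> and
    \<open>v * K\<close>, which contains the factor \<open>w - v\<close>.\<close>
  also have "\<dots> = w * (A w + \<epsilon> * w) * (A v - \<epsilon> * v) - v * (A v + \<epsilon> * v) * (A w - \<epsilon> * w)"
    unfolding A_def by algebra
  finally have key: "v * K < w * L"
    using D by (simp add: K_def L_def field_simps)
  have eq: "v * \<beta> powr (1 - \<rho>) = \<beta>" "w * \<gamma> powr (1 - \<rho>) = \<gamma>"
    using assms by (simp_all add: v_def w_def flip: powr_add)
  have "0 \<le> L"
  proof -
    have "0 \<le> \<epsilon> * w" using \<epsilon> v by simp
    then show ?thesis unfolding L_def using D by (intro divide_nonneg_nonneg) linarith+
  qed
  have "\<beta> * K = \<beta> powr (1 - \<rho>) * (v * K)"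
    by (subst (1) eq(1)[symmetric]) (simp only: ac_simps)
  also have "\<dots> < \<beta> powr (1 - \<rho>) * (w * L)"
    using key assms by simp
  also have "\<dots> \<le> \<gamma> powr (1 - \<rho>) * (w * L)"
    using assms rho_le v \<open>0 \<le> L\<close> by (intro mult_right_mono) (auto intro: powr_mono2)
  also have "\<dots> = \<gamma> * L"
    by (subst (2) eq(2)[symmetric]) (simp only: ac_simps)
  finally show ?thesis
    using assms form[of \<beta>] form[of \<gamma>] by (simp add: v_def w_def K_def L_def)
qed

lemma slope_before_le_iff: "0 < \<beta> \<Longrightarrow> 0 < \<gamma> \<Longrightarrow> slope_before \<beta> \<le> slope_before \<gamma> \<longleftrightarrow> \<beta> \<le> \<gamma>"
  using slope_before_strict_mono[of \<beta> \<gamma>] slope_before_strict_mono[of \<gamma> \<beta>] by force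

lemma slope_before_pos: "\<beta> > 0 \<Longrightarrow> slope_before \<beta> > 0"
  using factor_bounds[of \<beta>] by (simp add: slope_before_def)

text \<open>By \<open>slope_inverse\<close>, \<open>slope_after\<close> is
  \<open>slope_before\<close> conjugated by inversion, which reverses the order twice.\<close>

lemma slope_after_le_iff:
  assumes "0 < \<beta>" "0 < \<gamma>"
  shows "slope_after \<beta> \<le> slope_after \<gamma> \<longleftrightarrow> \<beta> \<le> \<gamma>"
proof -
  have "slope_after \<beta> = 1 / slope_before (1 / \<beta>)" "slope_after \<gamma> = 1 / slope_before (1 / \<gamma>)"
    using slope_inverse[of "1 / \<beta>"] slope_inverse[of "1 / \<gamma>"] assms by simp_all
  moreover have "slope_before (1 / \<gamma>) \<le> slope_before (1 / \<beta>) \<longleftrightarrow> \<beta> \<le> \<gamma>"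
    using assms by (simp add: slope_before_le_iff field_simps)
  moreover have "0 < slope_before (1 / \<beta>)" "0 < slope_before (1 / \<gamma>)"
    using assms by (simp_all add: slope_before_pos)
  ultimately show ?thesis by (simp add: frac_le_eq divide_le_cancel flip: inverse_eq_divide)
qed

text \<open>Since \<open>cx < cy\<close>, the identity lies strictly between the two slopes. This
  forces orbits to decrease and rules out a positive limit; the bound \<open>2 * \<beta>\<close>
  serves surjectivity.\<close>

lemma slope_bounds:
  assumes "\<beta> > 0"
  shows "\<beta> < slope_before \<beta>" "slope_before \<beta> < 2 * \<beta>" "slope_after \<beta> < \<beta>" "0 < slope_after \<beta>"
proof -
  note b = factor_bounds[OF assms]
  have "\<kappa> * cx \<rho> \<beta> < \<kappa> * cy \<rho> \<beta>"
    using cx_less_cy[OF assms rho_pos] kappa_pos by simp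
  moreover have "1 + \<kappa> * cy \<rho> \<beta> < 2 * (1 + \<kappa> * cx \<rho> \<beta>)" using b(1,7) by argo
  ultimately show "\<beta> < slope_before \<beta>" "slope_before \<beta> < 2 * \<beta>" "slope_after \<beta> < \<beta>" "0 < slope_after \<beta>"
    using b assms unfolding slope_before_def slope_after_def
    by (simp_all add: less_divide_eq divide_less_eq)
qed

lemma continuous_on_slope:
  "continuous_on {0<..} slope_before" "continuous_on {0<..} slope_after"
proof -
  have "1 + \<kappa> * cx \<rho> \<beta> \<noteq> 0" "1 - \<kappa> * cx \<rho> \<beta> \<noteq> 0" if "\<beta> > 0" for \<beta>
    using factor_bounds(1,2)[OF that] by linarith+
  then show "continuous_on {0<..} slope_before" "continuous_on {0<..} slope_after"
    unfolding slope_before_def[abs_def] slope_after_def[abs_def]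
    by (auto intro!: continuous_intros)
qed

lemma slope_before_surj:
  assumes "v > 0"
  obtains \<beta> where "\<beta> > 0" "slope_before \<beta> = v"
proof -
  have "\<exists>\<beta>\<ge>v / 2. \<beta> \<le> v \<and> slope_before \<beta> = v"
  proof (rule IVT')
    show "slope_before (v / 2) \<le> v" "v \<le> slope_before v"
      using slope_bounds[of "v / 2"] slope_bounds[of v] assms by auto
    show "continuous_on {v / 2..v} slope_before"
      using continuous_on_slope(1) by (rule continuous_on_subset) (use assms in auto)
  qed (use assms in auto)
  then obtain \<beta> where "v / 2 \<le> \<beta>" "slope_before \<beta> = v" by blast
  with that[of \<beta>] assms show ?thesis by linarith
qed

section \<open>Basic properties and symmetries of orbits\<close>

lemma orbitD:
  assumes "orbit \<beta> d x y"
  shows "0 < \<beta> i" "0 < d i"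
    "x i = d i * (1 + \<kappa> * cx \<rho> (\<beta> i))" "x (i + 1) = d i * (1 - \<kappa> * cx \<rho> (\<beta> i))"
    "y i = \<beta> i * d i * (1 + \<kappa> * cy \<rho> (\<beta> i))" "y (i + 1) = \<beta> i * d i * (1 - \<kappa> * cy \<rho> (\<beta> i))"
  using assms unfolding orbit_def by blast+

lemma orbit_pos:
  assumes "orbit \<beta> d x y"
  shows "0 < x i" "0 < y i"
  using orbitD[OF assms, of i] factor_bounds[of "\<beta> i"] by simp_all

lemma orbit_slope:
  assumes "orbit \<beta> d x y"
  shows "y i = slope_before (\<beta> i) * x i" "y (i + 1) = slope_after (\<beta> i) * x (i + 1)"
  using orbitD[OF assms, of i] factor_bounds[of "\<beta> i"]
  by (simp_all add: slope_before_def slope_after_def)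

lemma orbit_step:
  assumes "orbit \<beta> d x y"
  shows "slope_before (\<beta> (i + 1)) = slope_after (\<beta> i)"
  using orbit_slope(1)[OF assms, of "i + 1"] orbit_slope(2)[OF assms, of i] orbit_pos[OF assms, of "i + 1"]
  by simp

lemma orbit_shift:
  assumes "orbit \<beta> d x y"
  shows "orbit (\<lambda>i. \<beta> (i + j)) (\<lambda>i. d (i + j)) (\<lambda>i. x (i + j)) (\<lambda>i. y (i + j))"
proof -
  have shift: "i + 1 + j = (i + j) + 1" for i by simp
  show ?thesis
    unfolding orbit_def shift by (intro allI conjI orbitD[OF assms])
qed

text \<open>Reversal with exchanged players. Increment \<open>i\<close> lies between sites
  \<open>i - 1\<close> and \<open>i\<close>, so it goes to \<open>1 - i\<close> while site
  \<open>i\<close> goes to \<open>- i\<close>.\<close>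

lemma orbit_reflect:
  assumes "orbit \<beta> d x y"
  shows "orbit (\<lambda>i. 1 / \<beta> (- i)) (\<lambda>i. \<beta> (- i) * d (- i)) (\<lambda>i. y (1 - i)) (\<lambda>i. x (1 - i))"
  unfolding orbit_def
proof (intro allI)
  fix i
  show "0 < 1 / \<beta> (- i) \<and> 0 < \<beta> (- i) * d (- i) \<and>
     y (1 - i) = \<beta> (- i) * d (- i) * (1 + \<kappa> * cx \<rho> (1 / \<beta> (- i))) \<and>
     y (1 - (i + 1)) = \<beta> (- i) * d (- i) * (1 - \<kappa> * cx \<rho> (1 / \<beta> (- i))) \<and>
     x (1 - i) = 1 / \<beta> (- i) * (\<beta> (- i) * d (- i)) * (1 + \<kappa> * cy \<rho> (1 / \<beta> (- i))) \<and>
     x (1 - (i + 1)) = 1 / \<beta> (- i) * (\<beta> (- i) * d (- i)) * (1 - \<kappa> * cy \<rho> (1 / \<beta> (- i)))"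
    using orbitD[OF assms, of "- i"] by (simp add: cx_inverse cy_inverse)
qed

section \<open>Order and asymptotics of orbits\<close>

text \<open>Both slopes are strictly increasing, so the recursion preserves order. The equivalence
  allows propagation to the left as well.\<close>

lemma orbit_le_step:
  assumes "orbit \<beta> d x y" "orbit \<gamma> e u v"
  shows "\<beta> (i + 1) \<le> \<gamma> (i + 1) \<longleftrightarrow> \<beta> i \<le> \<gamma> i"
proof -
  note pos = orbitD(1)[OF assms(1)] orbitD(1)[OF assms(2)]
  have "\<beta> (i + 1) \<le> \<gamma> (i + 1) \<longleftrightarrow> slope_after (\<beta> i) \<le> slope_after (\<gamma> i)"
    unfolding orbit_step[OF assms(1), symmetric] orbit_step[OF assms(2), symmetric]
    by (simp add: slope_before_le_iff pos)
  then show ?thesis by (simp add: slope_after_le_iff pos)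
qed

lemma orbit_le:
  assumes "orbit \<beta> d x y" "orbit \<gamma> e u v" "\<beta> 0 \<le> \<gamma> 0"
  shows "\<beta> i \<le> \<gamma> i"
proof (induction i rule: int_induct[where k = 0])
  case (step2 i)
  then show ?case using orbit_le_step[OF assms(1,2), of "i - 1"] by simp
next
  case (step1 i)
  then show ?case using orbit_le_step[OF assms(1,2), of i] by simp
qed (rule assms(3))

lemma orbit_decreasing:
  assumes "orbit \<beta> d x y"
  shows "\<beta> (i + 1) < \<beta> i"
  using slope_bounds(1)[OF orbitD(1)[OF assms], of "i + 1"] slope_bounds(3)[OF orbitD(1)[OF assms], of i]
    orbit_step[OF assms, of i] by linarith

lemma orbit_antimono:
  assumes "orbit \<beta> d x y" "i \<le> j"
  shows "\<beta> j \<le> \<beta> i"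
  using assms(2)
proof (induction j rule: int_ge_induct)
  case (step j)
  then show ?case using orbit_decreasing[OF assms(1), of j] by linarith
qed simp

text \<open>Otherwise the decreasing ratios converge to some \<open>L > 0\<close>, and continuity
  gives \<open>slope_before L = slope_after L\<close>, contradicting
  \<open>slope_bounds\<close>.\<close>

lemma orbit_eventually_small:
  assumes "orbit \<beta> d x y" "0 < c"
  obtains N where "\<And>i. N \<le> i \<Longrightarrow> \<beta> i < c"
proof (cases "\<exists>N. \<beta> N < c")
  case True
  then obtain N where "\<beta> N < c" by blast
  with orbit_antimono[OF assms(1)] show ?thesis by (intro that[of N]) (rule le_less_trans)
next
  case False
  then have ge: "c \<le> \<beta> i" for i by (simp add: not_less)
  define X where "X = (\<lambda>k::nat. \<beta> (int k))"
  have "decseq X"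
    unfolding X_def by (intro decseq_SucI orbit_antimono[OF assms(1)]) auto
  then obtain L where L: "X \<longlonglongrightarrow> L" using decseq_convergent[of X c] ge X_def by metis
  have Lc: "c \<le> L" using L by (rule LIMSEQ_le_const) (auto simp: X_def ge)
  then have L0: "L > 0" using assms(2) by simp
  have "isCont slope_before L" "isCont slope_after L"
    using continuous_on_slope L0 by (auto simp: continuous_on_eq_continuous_at)
  then have "(\<lambda>k. slope_before (X (Suc k))) \<longlonglongrightarrow> slope_before L"
    "(\<lambda>k. slope_after (X k)) \<longlonglongrightarrow> slope_after L"
    using L LIMSEQ_Suc[OF L] isCont_tendsto_compose by blast+
  moreover have "slope_before (X (Suc k)) = slope_after (X k)" for k
    using orbit_step[OF assms(1), of "int k"] by (simp add: X_def add.commute)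
  ultimately have "slope_before L = slope_after L"
    using LIMSEQ_unique by auto
  then show ?thesis using slope_bounds[OF L0] by linarith
qed

text \<open>Smallness of the reflected orbit makes \<open>\<beta>\<close> large far to the left.
  Without a crossing, \<open>c \<le> \<beta> j\<close> would then propagate to the right
  forever.\<close>

lemma orbit_crossing:
  assumes "orbit \<beta> d x y" "0 < c"
  obtains j where "\<beta> (j + 1) \<le> c" "c \<le> \<beta> j"
proof -
  obtain M where M: "\<And>i. M \<le> i \<Longrightarrow> 1 / \<beta> (- i) < 1 / c"
    using orbit_eventually_small[OF orbit_reflect[OF assms(1)], of "1 / c"] assms(2) by auto
  have M': "c \<le> \<beta> (- M)"
    using M[of M] orbitD(1)[OF assms(1), of "- M"] assms(2) by (simp add: field_simps)
  obtain N where N: "\<And>i. N \<le> i \<Longrightarrow> \<beta> i < c"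
    using orbit_eventually_small[OF assms] by blast
  have "\<exists>j. \<beta> (j + 1) \<le> c \<and> c \<le> \<beta> j"
  proof (rule ccontr)
    assume no: "\<not> ?thesis"
    have "c \<le> \<beta> j" if "- M \<le> j" for j
      using that
    proof (induction j rule: int_ge_induct)
      case (step j)
      then show ?case using no by (meson linear)
    qed (rule M')
    from this[of "max N (- M)"] N[of "max N (- M)"] show False by simp
  qed
  then show ?thesis using that by blast
qed

section \<open>Summability of the increments\<close>

text \<open>Where \<open>\<beta>\<close> is small, both drift coefficients are at least 1/2, so the
  increments decay geometrically.\<close>

lemma orbit_summable_right:
  assumes "orbit \<beta> d x y"
  obtains N where "x summable_on {N..}" "y summable_on {N..}"
proof -
  \<comment> \<open>Chosen so that \<open>share \<rho> c = 1 / 9\<close>; then \<open>cx\<close> is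
    at least \<open>1 - 2/9 - 2/9\<close>, which exceeds 1/2.\<close>
  define c where "c = (1 / 8) powr (1 / \<rho>)"
  have "c > 0" by (simp add: c_def)
  then obtain N where N: "\<And>i. N \<le> i \<Longrightarrow> \<beta> i < c"
    using orbit_eventually_small[OF assms] by blast
  have small: "\<kappa> / 2 \<le> \<kappa> * cx \<rho> (\<beta> i)" "\<kappa> / 2 \<le> \<kappa> * cy \<rho> (\<beta> i)" if "N \<le> i" for i
  proof -
    define s where "s = share \<rho> (\<beta> i)"
    have \<beta>: "0 < \<beta> i" using orbitD(1)[OF assms] .
    have "share \<rho> c = 1 / 9" using rho_pos by (simp add: share_def c_def powr_powr)
    then have s: "0 < s" "s \<le> 1 / 9"
      using share_mono[OF \<beta> less_imp_le[OF N[OF that]] rho_pos] share_bounds[OF \<beta>] by (auto simp: s_def)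
    have "\<rho> * (s * (1 - s)) \<le> 1 * (s * 1)"
      using s rho_pos rho_le by (intro mult_mono) auto
    then have "1 / 2 \<le> cx \<rho> (\<beta> i)"
      using s unfolding cx_def s_def[symmetric] mult.assoc by linarith
    moreover from this have "1 / 2 \<le> cy \<rho> (\<beta> i)"
      using cx_less_cy[OF \<beta> rho_pos] by linarith
    ultimately show "\<kappa> / 2 \<le> \<kappa> * cx \<rho> (\<beta> i)" "\<kappa> / 2 \<le> \<kappa> * cy \<rho> (\<beta> i)"
      using kappa_pos by auto
  qed
  have decay: "e * (1 - t) \<le> (1 - \<kappa> / 2) * (e * (1 + t))" if "0 < e" "\<kappa> / 2 \<le> t" for e t
  proof -
    have "0 \<le> (1 - \<kappa> / 2) * t" using that kappa_pos kappa_less by simp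
    then have "1 - t \<le> (1 - \<kappa> / 2) * (1 + t)" using that by (simp add: algebra_simps)
    then have "e * (1 - t) \<le> e * ((1 - \<kappa> / 2) * (1 + t))" using that by simp
    then show ?thesis by (simp only: ac_simps)
  qed
  have "x (i + 1) \<le> (1 - \<kappa> / 2) * x i" "y (i + 1) \<le> (1 - \<kappa> / 2) * y i" if "N \<le> i" for i
    using decay small[OF that] orbitD(1,2)[OF assms, of i]
    unfolding orbitD(3-6)[OF assms, of i] by simp_all
  moreover have "1 - \<kappa> / 2 < 1" using kappa_pos by simp
  ultimately show ?thesis
    using that ratio_summable_on_atLeast orbit_pos[OF assms] by meson
qed

text \<open>Reflection turns the right tail into a left tail; a finite range closes any gap between
  the two.\<close>

lemma orbit_summable:
  assumes "orbit \<beta> d x y"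
  shows "x summable_on UNIV" "y summable_on UNIV"
proof -
  obtain N where N: "x summable_on {N..}" "y summable_on {N..}"
    using orbit_summable_right[OF assms] .
  obtain M where M: "(\<lambda>i. y (1 - i)) summable_on {M..}" "(\<lambda>i. x (1 - i)) summable_on {M..}"
    using orbit_summable_right[OF orbit_reflect[OF assms]] .
  have bij: "bij_betw (\<lambda>i. 1 - i) {M..} {..1 - M}"
    by (rule bij_betwI[where g = "\<lambda>i. 1 - i"]) auto
  have M': "x summable_on {..1 - M}" "y summable_on {..1 - M}"
    using M summable_on_reindex_bij_betw[OF bij, of x] summable_on_reindex_bij_betw[OF bij, of y] by simp_all
  have "UNIV = {N..} \<union> {..1 - M} \<union> {1 - M..N}" by auto
  moreover have "z summable_on {N..} \<union> {..1 - M} \<union> {1 - M..N}"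
    if "z summable_on {N..}" "z summable_on {..1 - M}" for z :: "int \<Rightarrow> real"
    using that by (intro summable_on_union) auto
  ultimately show "x summable_on UNIV" "y summable_on UNIV"
    using N M' by metis+
qed

lemma orbit_infsum_pos:
  assumes "orbit \<beta> d x y"
  shows "0 < infsum x UNIV" "0 < infsum y UNIV"
proof -
  have "0 < infsum z UNIV" if "z summable_on UNIV" "\<And>i. 0 < z i" for z :: "int \<Rightarrow> real"
    using finite_sum_le_infsum[OF that(1), of "{0}"] that(2)[of 0] less_imp_le[OF that(2)]
    by simp
  then show "0 < infsum x UNIV" "0 < infsum y UNIV"
    using orbit_summable[OF assms] orbit_pos[OF assms] by blast+
qed

section \<open>Comparison of total increments\<close>

text \<open>Interlacing at the start persists at all sites, so \<open>interlaced_bounds\<close>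
  compares the \<open>x\<close> and the \<open>y\<close> increments, losing \<open>q\<^sup>2\<close>
  each time. Comparing the slopes at site 0 removes the normalisations.\<close>

lemma orbit_infsum_le_interlaced:
  assumes orb: "orbit \<beta> d x y" and orb': "orbit \<beta>' d' x' y'"
    and start: "\<beta> 1 \<le> \<beta>' 0" "\<beta>' 0 \<le> \<beta> 0"
  shows "(1 - 3 * \<kappa>) ^ 4 * (infsum y' UNIV * infsum x UNIV) \<le> infsum y UNIV * infsum x' UNIV"
proof -
  \<comment> \<open>A common lower bound for \<open>(1 - t) / (1 + t)\<close> and its reciprocal
    when \<open>t\<close> is at most \<open>3/2 * \<kappa>\<close> in absolute value.\<close>
  define q where "q = 1 - 3 * \<kappa>"
  have q: "0 < q" "q \<le> 1" using kappa_pos kappa_less by (auto simp: q_def)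
  have le: "\<beta>' i \<le> \<beta> i" and ge: "\<beta> (i + 1) \<le> \<beta>' i" for i
    using orbit_le[OF orb' orb start(2)] orbit_le[OF orbit_shift[OF orb, of 1] orb'] start(1) by auto
  \<comment> \<open>The ratio of consecutive increments at a site with drift \<open>t\<close>. It
    decreases in \<open>t\<close>, hence increases with the stake ratio.\<close>
  define R where "R = (\<lambda>t :: real. (1 - t) / (1 + t))"
  have R_mono: "R t \<le> R s" if "s \<le> t" "-1 < s" for s t
  proof -
    have "0 < 1 + s" "0 < 1 + t" using that by auto
    then show ?thesis using that(1) by (simp add: R_def field_simps)
  qed
  have R_bounds: "q \<le> R t" "q * R t \<le> 1" "0 < R t" if "\<bar>t\<bar> \<le> 3/2 * \<kappa>" for t
  proof -
    have t: "0 < 1 + t" "0 < 1 - t" using that kappa_less by auto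
    have 1: "q * (1 + s) \<le> 1 - s" if "\<bar>s\<bar> \<le> 3/2 * \<kappa>" for s
    proof -
      have "q * (1 + s) \<le> q * (1 + 3/2 * \<kappa>)" using that q by (intro mult_left_mono) auto
      also have "\<dots> \<le> 1 - 3/2 * \<kappa>" using kappa_pos by (simp add: q_def algebra_simps)
      finally show ?thesis using that by linarith
    qed
    show "q \<le> R t" "q * R t \<le> 1" "0 < R t"
      using t 1[of t] 1[of "- t"] that by (simp_all add: R_def field_simps)
  qed
  have compare: "q\<^sup>2 * (z' 0 * z i) \<le> z' i * z 0 \<and> q\<^sup>2 * (z' i * z 0) \<le> z' 0 * z i"
    if "\<And>i. 0 < z i" "\<And>i. 0 < z' i"
      and z: "\<And>i. z (i + 1) = R (\<kappa> * f (\<beta> i)) * z i" and z': "\<And>i. z' (i + 1) = R (\<kappa> * f (\<beta>' i)) * z' i"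
      and f: "\<And>a b. 0 < a \<Longrightarrow> a \<le> b \<Longrightarrow> f b \<le> f a" "\<And>a. 0 < a \<Longrightarrow> \<bar>\<kappa> * f a\<bar> \<le> 3/2 * \<kappa>"
    for z z' f i
  proof (rule interlaced_bounds[of z z' "\<lambda>i. R (\<kappa> * f (\<beta> i))" "\<lambda>i. R (\<kappa> * f (\<beta>' i))"])
    fix i
    have pos: "0 < \<beta> j" "0 < \<beta>' j" for j
      using orbitD(1)[OF orb] orbitD(1)[OF orb'] by auto
    have mono: "R (\<kappa> * f a) \<le> R (\<kappa> * f b)" if "0 < a" "a \<le> b" for a b
      using f(1)[OF that] f(2)[of b] that kappa_pos kappa_less by (intro R_mono) auto
    show "R (\<kappa> * f (\<beta> (i + 1))) \<le> R (\<kappa> * f (\<beta>' i))" "R (\<kappa> * f (\<beta>' i)) \<le> R (\<kappa> * f (\<beta> i))"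
      using mono pos le ge by auto
    show "q \<le> R (\<kappa> * f (\<beta> i))" "q * R (\<kappa> * f (\<beta> i)) \<le> 1" "0 < R (\<kappa> * f (\<beta>' i))"
      using R_bounds f(2) pos by auto
  qed (use that q in auto)
  have ratio: "u (i + 1) = R (\<kappa> * cx \<rho> (\<gamma> i)) * u i \<and> v (i + 1) = R (\<kappa> * cy \<rho> (\<gamma> i)) * v i"
    if "orbit \<gamma> e u v" for \<gamma> e u v i
    using factor_bounds[OF orbitD(1)[OF that], of i]
    unfolding orbitD(3-6)[OF that, of i] by (simp add: R_def)
  \<comment> \<open>The opposite halves of \<open>compare\<close> are taken for \<open>x\<close> and
    \<open>y\<close>, since the claim bounds \<open>y\<close> sums against \<open>x\<close> sums in
    one direction.\<close>
  have X: "q\<^sup>2 * (x' 0 * x i) \<le> x' i * x 0" and Y: "q\<^sup>2 * (y' i * y 0) \<le> y' 0 * y i" for i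
    using compare[of x x' "cx \<rho>" i] compare[of y y' "cy \<rho>" i] ratio[OF orb] ratio[OF orb']
      orbit_pos[OF orb] orbit_pos[OF orb'] cx_cy_antimono[OF _ _ rho_pos rho_le] abs_kcx_le abs_kcy_le
    by blast+
  have sum: "q\<^sup>2 * (c * infsum u UNIV) \<le> e * infsum v UNIV"
    if "u summable_on UNIV" "v summable_on UNIV" "\<And>i. q\<^sup>2 * (c * u i) \<le> e * v i" for u v :: "int \<Rightarrow> real" and c e
    using infsum_mono[of "\<lambda>i. q\<^sup>2 * (c * u i)" UNIV "\<lambda>i. e * v i"] that
    by (simp add: infsum_cmult_right' summable_on_cmult_right)
  have SX: "q\<^sup>2 * (x' 0 * infsum x UNIV) \<le> x 0 * infsum x' UNIV"
    by (rule sum) (use X orbit_summable orb orb' in \<open>auto simp: mult.commute\<close>)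
  have SY: "q\<^sup>2 * (y 0 * infsum y' UNIV) \<le> y' 0 * infsum y UNIV"
    by (rule sum) (use Y orbit_summable orb orb' in \<open>auto simp: mult.commute\<close>)
  note pos = orbit_pos[OF orb, of 0] orbit_pos[OF orb', of 0] orbit_infsum_pos[OF orb] orbit_infsum_pos[OF orb']
  have "slope_before (\<beta>' 0) \<le> slope_before (\<beta> 0)"
    using start orbitD(1)[OF orb] orbitD(1)[OF orb'] by (simp add: slope_before_le_iff)
  then have "y' 0 * x 0 \<le> y 0 * x' 0"
    using pos mult_right_mono[of "slope_before (\<beta>' 0)" "slope_before (\<beta> 0)" "x 0 * x' 0"]
    unfolding orbit_slope(1)[OF orb, of 0] orbit_slope(1)[OF orb', of 0] by (simp add: ac_simps)
  then have "(y' 0 * x 0) * (infsum y UNIV * infsum x' UNIV) \<le> (y 0 * x' 0) * (infsum y UNIV * infsum x' UNIV)"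
    using pos by (intro mult_right_mono) auto
  moreover have "(q\<^sup>2 * (x' 0 * infsum x UNIV)) * (q\<^sup>2 * (y 0 * infsum y' UNIV))
      \<le> (x 0 * infsum x' UNIV) * (y' 0 * infsum y UNIV)"
    using pos by (intro mult_mono[OF SX SY]) auto
  moreover have "(q\<^sup>2 * (x' 0 * infsum x UNIV)) * (q\<^sup>2 * (y 0 * infsum y' UNIV))
      = (y 0 * x' 0) * (q ^ 4 * (infsum y' UNIV * infsum x UNIV))"
    by (simp add: power4_eq_xxxx power2_eq_square)
  moreover have "(x 0 * infsum x' UNIV) * (y' 0 * infsum y UNIV) = (y' 0 * x 0) * (infsum y UNIV * infsum x' UNIV)"
    by simp
  ultimately have "(y 0 * x' 0) * (q ^ 4 * (infsum y' UNIV * infsum x UNIV))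
      \<le> (y 0 * x' 0) * (infsum y UNIV * infsum x' UNIV)"
    by linarith
  then show ?thesis using pos by (simp add: q_def)
qed

text \<open>Reflection exchanges the two sums. Comparing an orbit with its own reflection therefore
  bounds the square of their ratio, and a square root turns the power 4 into 2.\<close>

lemma orbit_infsum_le:
  assumes "orbit \<beta> d x y"
  shows "(1 - 3 * \<kappa>)\<^sup>2 * infsum x UNIV \<le> infsum y UNIV"
proof -
  have "0 < 1 / \<beta> 0" using orbitD(1)[OF assms, of 0] by simp
  \<comment> \<open>The reflected orbit has ratio \<open>1 / \<beta> 0\<close> at site 0; shifting
    by \<open>j\<close> interlaces the original with it.\<close>
  then obtain j where j: "\<beta> (j + 1) \<le> 1 / \<beta> 0" "1 / \<beta> 0 \<le> \<beta> j"
    using orbit_crossing[OF assms] by blast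
  have shift: "infsum (\<lambda>i. z (i + j)) UNIV = infsum z UNIV" for z :: "int \<Rightarrow> real"
    by (rule infsum_reindex_bij_betw) (rule bij_betwI[where g = "\<lambda>i. i - j"]; simp)
  have reflect: "infsum (\<lambda>i. z (1 - i)) UNIV = infsum z UNIV" for z :: "int \<Rightarrow> real"
    by (rule infsum_reindex_bij_betw) (rule bij_betwI[where g = "\<lambda>i. 1 - i"]; simp)
  have "(1 - 3 * \<kappa>) ^ 4 * (infsum x UNIV * infsum x UNIV) \<le> infsum y UNIV * infsum y UNIV"
    using orbit_infsum_le_interlaced[OF orbit_shift[OF assms, of j] orbit_reflect[OF assms]] j
    by (simp add: shift reflect add.commute)
  then have "((1 - 3 * \<kappa>)\<^sup>2 * infsum x UNIV)\<^sup>2 \<le> (infsum y UNIV)\<^sup>2"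
    by (simp add: power2_eq_square power4_eq_xxxx mult.assoc mult.left_commute)
  then show ?thesis
    using orbit_infsum_pos[OF assms] by (auto dest!: power2_le_imp_le)
qed

lemma orbit_infsum_ge:
  assumes "orbit \<beta> d x y"
  shows "(1 - 3 * \<kappa>)\<^sup>2 * infsum y UNIV \<le> infsum x UNIV"
proof -
  have "infsum (\<lambda>i. z (1 - i)) UNIV = infsum z UNIV" for z :: "int \<Rightarrow> real"
    by (rule infsum_reindex_bij_betw) (rule bij_betwI[where g = "\<lambda>i. 1 - i"]; simp)
  then show ?thesis using orbit_infsum_le[OF orbit_reflect[OF assms]] by simp
qed

section \<open>The ABMN system\<close>

text \<open>Dividing by \<open>A + B\<close> leaves only \<open>s = B / (A + B)\<close>: the weights
  become \<open>1 \<plusminus> \<kappa> * (1 - 2 * s)\<close>, and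
  \<open>A * B / (A + B)\<^sup>2\<close> is \<open>s * (1 - s)\<close>.\<close>

lemma ABMN_reduced:
  fixes s a b :: real
  assumes "0 < a" "0 < b"
  defines "s \<equiv> share \<rho> (b / a)"
  shows "2 * (a powr \<rho> + b powr \<rho>) * (m + a)
       = (a powr \<rho> * (1 - \<kappa>) + b powr \<rho> * (1 + \<kappa>)) * m\<^sub>1 + (a powr \<rho> * (1 + \<kappa>) + b powr \<rho> * (1 - \<kappa>)) * m\<^sub>2
     \<longleftrightarrow> 2 * (m + a) = (1 - \<kappa> * (1 - 2 * s)) * m\<^sub>1 + (1 + \<kappa> * (1 - 2 * s)) * m\<^sub>2"
    (is ?mean_a)
    and "2 * (a powr \<rho> + b powr \<rho>) * (n + b)
       = (a powr \<rho> * (1 - \<kappa>) + b powr \<rho> * (1 + \<kappa>)) * n\<^sub>1 + (a powr \<rho> * (1 + \<kappa>) + b powr \<rho> * (1 - \<kappa>)) * n\<^sub>2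
     \<longleftrightarrow> 2 * (n + b) = (1 - \<kappa> * (1 - 2 * s)) * n\<^sub>1 + (1 + \<kappa> * (1 - 2 * s)) * n\<^sub>2"
    (is ?mean_b)
    and "(a powr \<rho> + b powr \<rho>)\<^sup>2 = \<rho> * \<kappa> * a powr (\<rho> - 1) * b powr \<rho> * e
     \<longleftrightarrow> a = \<rho> * \<kappa> * (s * (1 - s)) * e"
    (is ?stake_a)
    and "(a powr \<rho> + b powr \<rho>)\<^sup>2 = \<rho> * \<kappa> * a powr \<rho> * b powr (\<rho> - 1) * e
     \<longleftrightarrow> b = \<rho> * \<kappa> * (s * (1 - s)) * e"
    (is ?stake_b)
proof -
  define A B where "A = a powr \<rho>" and "B = b powr \<rho>"
  have AB: "0 < A" "0 < B" using assms by (simp_all add: A_def B_def)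
  have s: "s = B / (A + B)"
    using assms AB by (simp add: s_def share_def powr_divide A_def[symmetric] B_def[symmetric] field_simps)
  have mean: "2 * (A + B) * z = (A * (1 - \<kappa>) + B * (1 + \<kappa>)) * u + (A * (1 + \<kappa>) + B * (1 - \<kappa>)) * v
     \<longleftrightarrow> 2 * z = (1 - \<kappa> * (1 - 2 * s)) * u + (1 + \<kappa> * (1 - 2 * s)) * v" for z u v
  proof -
    have sB: "(A + B) * s = B" using AB by (simp add: s)
    have "(A + B) * (1 - \<kappa> * (1 - 2 * s)) = (A + B) * (1 - \<kappa>) + 2 * \<kappa> * ((A + B) * s)"
      "(A + B) * (1 + \<kappa> * (1 - 2 * s)) = (A + B) * (1 + \<kappa>) - 2 * \<kappa> * ((A + B) * s)"
      by (simp_all add: algebra_simps)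
    then have coeff: "A * (1 - \<kappa>) + B * (1 + \<kappa>) = (A + B) * (1 - \<kappa> * (1 - 2 * s))"
      "A * (1 + \<kappa>) + B * (1 - \<kappa>) = (A + B) * (1 + \<kappa> * (1 - 2 * s))"
      unfolding sB by (simp_all add: algebra_simps)
    have "2 * (A + B) * z = (A * (1 - \<kappa>) + B * (1 + \<kappa>)) * u + (A * (1 + \<kappa>) + B * (1 - \<kappa>)) * v
      \<longleftrightarrow> (A + B) * (2 * z) = (A + B) * ((1 - \<kappa> * (1 - 2 * s)) * u + (1 + \<kappa> * (1 - 2 * s)) * v)"
      unfolding coeff by (simp add: distrib_left ac_simps)
    also have "\<dots> \<longleftrightarrow> 2 * z = (1 - \<kappa> * (1 - 2 * s)) * u + (1 + \<kappa> * (1 - 2 * s)) * v"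
      using AB by simp
    finally show ?thesis .
  qed
  show ?mean_a ?mean_b
    using mean unfolding A_def B_def by blast+
  have ss: "s * (1 - s) = A * B / (A + B)\<^sup>2"
    using AB by (simp add: s field_simps power2_eq_square)
  have pred: "a powr (\<rho> - 1) = A / a" "b powr (\<rho> - 1) = B / b"
    using assms by (simp_all add: A_def B_def powr_diff)
  have stake: "(A + B)\<^sup>2 = P * e / t \<longleftrightarrow> t = P / (A + B)\<^sup>2 * e" if "0 < t" for t P
    using AB that by (auto simp: field_simps)
  have "\<rho> * \<kappa> * (s * (1 - s)) = \<rho> * \<kappa> * A * B / (A + B)\<^sup>2"
    by (simp add: ss)
  then show ?stake_a ?stake_b
    using stake[OF assms(1), of "\<rho> * \<kappa> * A * B"] stake[OF assms(2), of "\<rho> * \<kappa> * A * B"]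
    unfolding pred A_def[symmetric] B_def[symmetric] by simp_all
qed

lemma ABMN_iff:
  "(a, b, m, n) \<in> ABMN \<kappa> \<rho> \<longleftrightarrow> (\<forall>i. let s = share \<rho> (b i / a i) in
     0 < a i \<and> 0 < b i \<and>
     2 * (m i + a i) = (1 - \<kappa> * (1 - 2 * s)) * m (i - 1) + (1 + \<kappa> * (1 - 2 * s)) * m (i + 1) \<and>
     2 * (n i + b i) = (1 - \<kappa> * (1 - 2 * s)) * n (i - 1) + (1 + \<kappa> * (1 - 2 * s)) * n (i + 1) \<and>
     a i = \<rho> * \<kappa> * (s * (1 - s)) * (m (i + 1) - m (i - 1)) \<and>
     b i = \<rho> * \<kappa> * (s * (1 - s)) * (n (i - 1) - n (i + 1)))"
  unfolding ABMN_def mem_Collect_eq case_prod_conv Let_def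
  by (intro iff_allI conj_cong refl ABMN_reduced; assumption)

text \<open>With \<open>g = \<rho> * \<kappa> * (s * (1 - s))\<close> the stakes are
  \<open>g * M\<close> and \<open>g * N\<close>. Substituted into the mean equations, they shift the
  drift \<open>\<kappa> * (1 - 2 * s)\<close> by \<open>2 * g\<close> in opposite directions, giving
  \<open>cx\<close> and \<open>cy\<close>.\<close>

lemma ABMN_orbit:
  assumes "(a, b, m, n) \<in> ABMN \<kappa> \<rho>"
  shows "orbit (\<lambda>i. b i / a i) (\<lambda>i. (m (i + 1) - m (i - 1)) / 2) (\<lambda>i. m i - m (i - 1)) (\<lambda>i. n (i - 1) - n i)"
  unfolding orbit_def
proof (intro allI)
  fix i
  define s where "s = share \<rho> (b i / a i)"
  define M N where "M = m (i + 1) - m (i - 1)" and "N = n (i - 1) - n (i + 1)"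
  have ab: "0 < a i" "0 < b i" using assms by (auto simp: ABMN_def)
  define g where "g = \<rho> * \<kappa> * (s * (1 - s))"
  have g: "0 < g"
    using share_bounds[of "b i / a i" \<rho>] ab rho_pos kappa_pos by (simp add: g_def s_def)
  have red: "2 * (m i + a i) = (1 - \<kappa> * (1 - 2 * s)) * m (i - 1) + (1 + \<kappa> * (1 - 2 * s)) * m (i + 1)"
    "2 * (n i + b i) = (1 - \<kappa> * (1 - 2 * s)) * n (i - 1) + (1 + \<kappa> * (1 - 2 * s)) * n (i + 1)"
    "a i = g * M" "b i = g * N"
    using assms unfolding ABMN_iff Let_def s_def M_def N_def g_def by blast+
  have M: "0 < M" using ab red(3) g by (simp add: zero_less_mult_iff)
  have N: "b i / a i * (M / 2) = N / 2" using M g by (simp add: red)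
  have kc: "\<kappa> * cx \<rho> (b i / a i) = \<kappa> * (1 - 2 * s) - 2 * g" "\<kappa> * cy \<rho> (b i / a i) = \<kappa> * (1 - 2 * s) + 2 * g"
    by (simp_all add: cx_def cy_def s_def g_def algebra_simps)
  have "m i - m (i - 1) = M / 2 * (1 + \<kappa> * cx \<rho> (b i / a i))" "m (i + 1) - m i = M / 2 * (1 - \<kappa> * cx \<rho> (b i / a i))"
    using red(1,3) unfolding kc M_def by (simp_all add: field_simps)
  moreover have "n (i - 1) - n i = N / 2 * (1 + \<kappa> * cy \<rho> (b i / a i))" "n i - n (i + 1) = N / 2 * (1 - \<kappa> * cy \<rho> (b i / a i))"
    using red(2,4) unfolding kc N_def by (simp_all add: field_simps)
  ultimately show "0 < b i / a i \<and> 0 < (m (i + 1) - m (i - 1)) / 2 \<and>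
      m i - m (i - 1) = (m (i + 1) - m (i - 1)) / 2 * (1 + \<kappa> * cx \<rho> (b i / a i)) \<and>
      m (i + 1) - m (i + 1 - 1) = (m (i + 1) - m (i - 1)) / 2 * (1 - \<kappa> * cx \<rho> (b i / a i)) \<and>
      n (i - 1) - n i = b i / a i * ((m (i + 1) - m (i - 1)) / 2) * (1 + \<kappa> * cy \<rho> (b i / a i)) \<and>
      n (i + 1 - 1) - n (i + 1) = b i / a i * ((m (i + 1) - m (i - 1)) / 2) * (1 - \<kappa> * cy \<rho> (b i / a i))"
    using ab M unfolding M_def[symmetric] N by simp
qed

text \<open>Conversely, the stake equations dictate \<open>a\<close>, because \<open>2 * d i\<close>
  is the two-step increment of \<open>m\<close>.\<close>

lemma orbit_ABMN:
  assumes orb: "orbit \<beta> d x y"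
    and m: "\<And>i. m i - m (i - 1) = x i" and n: "\<And>i. n (i - 1) - n i = y i"
  defines "a \<equiv> \<lambda>i. \<rho> * \<kappa> * (share \<rho> (\<beta> i) * (1 - share \<rho> (\<beta> i))) * (2 * d i)"
  shows "(a, \<lambda>i. \<beta> i * a i, m, n) \<in> ABMN \<kappa> \<rho>"
proof -
  have *: "0 < a i" "0 < \<beta> i * a i"
    "2 * (m i + a i) = (1 - \<kappa> * (1 - 2 * share \<rho> (\<beta> i * a i / a i))) * m (i - 1)
      + (1 + \<kappa> * (1 - 2 * share \<rho> (\<beta> i * a i / a i))) * m (i + 1)"
    "2 * (n i + \<beta> i * a i) = (1 - \<kappa> * (1 - 2 * share \<rho> (\<beta> i * a i / a i))) * n (i - 1)
      + (1 + \<kappa> * (1 - 2 * share \<rho> (\<beta> i * a i / a i))) * n (i + 1)"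
    "a i = \<rho> * \<kappa> * (share \<rho> (\<beta> i * a i / a i) * (1 - share \<rho> (\<beta> i * a i / a i))) * (m (i + 1) - m (i - 1))"
    "\<beta> i * a i = \<rho> * \<kappa> * (share \<rho> (\<beta> i * a i / a i) * (1 - share \<rho> (\<beta> i * a i / a i))) * (n (i - 1) - n (i + 1))"
    for i
  proof -
    note o = orbitD[OF orb, of i]
    show pos: "0 < a i" "0 < \<beta> i * a i"
      using o(1,2) share_bounds[of "\<beta> i" \<rho>] rho_pos kappa_pos by (auto simp: a_def)
    have div: "\<beta> i * a i / a i = \<beta> i" using pos by simp
    define s g where "s = share \<rho> (\<beta> i)" and "g = \<rho> * \<kappa> * (s * (1 - s))"
    have a: "a i = g * (2 * d i)" by (simp add: a_def g_def s_def)
    have kc: "\<kappa> * cx \<rho> (\<beta> i) = \<kappa> * (1 - 2 * s) - 2 * g" "\<kappa> * cy \<rho> (\<beta> i) = \<kappa> * (1 - 2 * s) + 2 * g"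
      by (simp_all add: cx_def cy_def s_def g_def algebra_simps)
    have mm: "m i = m (i - 1) + d i * (1 + \<kappa> * cx \<rho> (\<beta> i))" "m (i + 1) = m (i - 1) + 2 * d i"
      using m[of i] m[of "i + 1"] o(3,4) by (simp_all add: algebra_simps)
    have nn: "n i = n (i - 1) - \<beta> i * d i * (1 + \<kappa> * cy \<rho> (\<beta> i))" "n (i + 1) = n (i - 1) - 2 * (\<beta> i * d i)"
      using n[of i] n[of "i + 1"] o(5,6) by (simp_all add: algebra_simps)
    show "2 * (m i + a i) = (1 - \<kappa> * (1 - 2 * share \<rho> (\<beta> i * a i / a i))) * m (i - 1)
      + (1 + \<kappa> * (1 - 2 * share \<rho> (\<beta> i * a i / a i))) * m (i + 1)"
      unfolding div unfolding mm kc a s_def[symmetric] by (simp add: algebra_simps)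
    show "2 * (n i + \<beta> i * a i) = (1 - \<kappa> * (1 - 2 * share \<rho> (\<beta> i * a i / a i))) * n (i - 1)
      + (1 + \<kappa> * (1 - 2 * share \<rho> (\<beta> i * a i / a i))) * n (i + 1)"
      unfolding div unfolding nn kc a s_def[symmetric] by (simp add: algebra_simps)
    show "a i = \<rho> * \<kappa> * (share \<rho> (\<beta> i * a i / a i) * (1 - share \<rho> (\<beta> i * a i / a i))) * (m (i + 1) - m (i - 1))"
      unfolding div unfolding mm a s_def[symmetric] g_def[symmetric] by simp
    show "\<beta> i * a i = \<rho> * \<kappa> * (share \<rho> (\<beta> i * a i / a i) * (1 - share \<rho> (\<beta> i * a i / a i))) * (n (i - 1) - n (i + 1))"
      unfolding div unfolding nn a s_def[symmetric] g_def[symmetric] by simp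
  qed
  show ?thesis
    unfolding ABMN_iff Let_def using * by blast
qed

section \<open>Existence of solutions\<close>

text \<open>The slope recursion produces \<open>\<beta>\<close>, and matching the two descriptions
  of \<open>x\<close> produces \<open>d\<close>. The two descriptions of \<open>y\<close> then agree
  by the recursion.\<close>

lemma orbit_exists:
  obtains \<beta> d x y where "orbit \<beta> d x y"
proof -
  have "\<forall>\<beta>. \<exists>\<gamma>. 0 < \<beta> \<longrightarrow> 0 < \<gamma> \<and> slope_before \<gamma> = slope_after \<beta>"
    using slope_before_surj slope_bounds(4) by metis
  then obtain T where T: "\<And>\<beta>. 0 < \<beta> \<Longrightarrow> 0 < T \<beta> \<and> slope_before (T \<beta>) = slope_after \<beta>"
    by metis
  define B where "B = (\<lambda>k. (T ^^ k) 1)"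
  have B: "0 < B k" for k
    by (induction k) (use T in \<open>auto simp: B_def\<close>)
  have B_step: "slope_before (B (Suc k)) = slope_after (B k)" for k
    using T[OF B[of k]] by (simp add: B_def)
  \<comment> \<open>Reversal inverts \<open>\<beta>\<close>, so the forward orbit of \<open>1\<close> extends to negative indices by taking inverses.\<close>
  define \<beta> where "\<beta> = (\<lambda>i. if 0 \<le> i then B (nat i) else 1 / B (nat (- i)))"
  have \<beta>: "0 < \<beta> i" for i using B by (simp add: \<beta>_def)
  \<comment> \<open>At \<open>k = 0\<close> the formula holds because \<open>B 0 = 1\<close> is its
    own inverse.\<close>
  have neg: "\<beta> (- int k) = 1 / B k" for k
    by (cases "k = 0") (auto simp: \<beta>_def B_def)
  have step: "slope_before (\<beta> (i + 1)) = slope_after (\<beta> i)" for i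
  proof (cases "0 \<le> i")
    case True
    then show ?thesis using B_step[of "nat i"] by (simp add: \<beta>_def nat_add_distrib)
  next
    case False
    define k where "k = nat (- i - 1)"
    have i: "i = - int (Suc k)" "i + 1 = - int k" using False by (auto simp: k_def)
    have "slope_before (1 / B k) = 1 / slope_after (B k)"
      using slope_inverse[of "1 / B k"] B[of k] by simp
    also have "\<dots> = slope_after (1 / B (Suc k))"
      using slope_inverse[OF B, of "Suc k"] B_step[of k] by simp
    finally show ?thesis unfolding i(2) neg by (simp only: i(1) neg)
  qed
  \<comment> \<open>The quotient \<open>d i / d (i - 1)\<close> forced by equating the two
    expressions for \<open>x i\<close>; logarithms make the product additive.\<close>
  define f where "f = (\<lambda>i. (1 - \<kappa> * cx \<rho> (\<beta> (i - 1))) / (1 + \<kappa> * cx \<rho> (\<beta> i)))"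
  obtain l where l: "\<And>i. l i - l (i - 1) = ln (f i)"
    using antidifference[of "\<lambda>i. ln (f i)"] by metis
  define d where "d = (\<lambda>i. exp (l i))"
  have f: "0 < f i" for i
    unfolding f_def using factor_bounds(1)[OF \<beta>[of i]] factor_bounds(2)[OF \<beta>[of "i - 1"]]
    by (intro divide_pos_pos) linarith+
  have dpos: "0 < d i" for i by (simp add: d_def)
  have "d (i + 1) = d i * f (i + 1)" for i
  proof -
    have "l (i + 1) = l i + ln (f (i + 1))" using l[of "i + 1"] by simp
    then show ?thesis using f by (simp add: d_def exp_add)
  qed
  then have d: "d (i + 1) * (1 + \<kappa> * cx \<rho> (\<beta> (i + 1))) = d i * (1 - \<kappa> * cx \<rho> (\<beta> i))" for i
    using factor_bounds(1)[OF \<beta>[of "i + 1"]] by (simp add: f_def)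
  have y: "\<beta> (i + 1) * d (i + 1) * (1 + \<kappa> * cy \<rho> (\<beta> (i + 1))) = \<beta> i * d i * (1 - \<kappa> * cy \<rho> (\<beta> i))" for i
  proof -
    have "\<beta> (i + 1) * d (i + 1) * (1 + \<kappa> * cy \<rho> (\<beta> (i + 1)))
        = slope_before (\<beta> (i + 1)) * (d (i + 1) * (1 + \<kappa> * cx \<rho> (\<beta> (i + 1))))"
      using factor_bounds(1)[OF \<beta>[of "i + 1"]] by (simp add: slope_before_def)
    also have "\<dots> = \<beta> i * d i * (1 - \<kappa> * cy \<rho> (\<beta> i))"
      unfolding step d using factor_bounds(2)[OF \<beta>[of i]] by (simp add: slope_after_def)
    finally show ?thesis .
  qed
  have "orbit \<beta> d (\<lambda>i. d i * (1 + \<kappa> * cx \<rho> (\<beta> i))) (\<lambda>i. \<beta> i * d i * (1 + \<kappa> * cy \<rho> (\<beta> i)))"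
    unfolding orbit_def using \<beta> d y dpos by blast
  then show ?thesis using that by blast
qed

text \<open>A lower bound on the supremum requires at least one element.\<close>

lemma ABMN_nonempty: "ABMN \<kappa> \<rho> \<noteq> {}"
proof -
  obtain \<beta> d x y where orb: "orbit \<beta> d x y" using orbit_exists .
  obtain m where m: "\<And>i. m i - m (i - 1) = x i" using antidifference by blast
  obtain n where n: "\<And>i. n i - n (i - 1) = y i" using antidifference by blast
  have "- n (i - 1) - - n i = y i" for i using n[of i] by simp
  then show ?thesis using orbit_ABMN[OF orb, of m "\<lambda>i. - n i"] m by blast
qed

section \<open>Bounds on the ratio and on its supremum\<close>

lemma ABMN_ratio_bounds:
  assumes "(a, b, m, n) \<in> ABMN \<kappa> \<rho>"
  defines "r \<equiv> (lim_neg n - lim_pos n) / (lim_pos m - lim_neg m)"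
  shows "\<bar>r - 1\<bar> \<le> 12 * \<kappa>"
proof -
  define x y where "x = (\<lambda>i. m i - m (i - 1))" and "y = (\<lambda>i. n (i - 1) - n i)"
  have orb: "orbit (\<lambda>i. b i / a i) (\<lambda>i. (m (i + 1) - m (i - 1)) / 2) x y"
    unfolding x_def y_def using assms(1) by (rule ABMN_orbit)
  obtain P Q where "(\<lambda>k. m (int k)) \<longlonglongrightarrow> P" "(\<lambda>k. m (- int k)) \<longlonglongrightarrow> Q" "P - Q = infsum x UNIV"
    using telescoping_limits[OF orbit_summable(1)[OF orb], of m] by (auto simp: x_def)
  then have X: "lim_pos m - lim_neg m = infsum x UNIV"
    by (simp add: lim_pos_def lim_neg_def limI)
  \<comment> \<open>The sign is reversed because \<open>y\<close> records decrements of
    \<open>n\<close>.\<close>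
  obtain P Q where "(\<lambda>k. - n (int k)) \<longlonglongrightarrow> P" "(\<lambda>k. - n (- int k)) \<longlonglongrightarrow> Q" "P - Q = infsum y UNIV"
    using telescoping_limits[OF orbit_summable(2)[OF orb], of "\<lambda>i. - n i"] by (auto simp: y_def)
  moreover from this(1,2) have "lim_pos n = - P" "lim_neg n = - Q"
    unfolding lim_pos_def lim_neg_def by (auto intro!: limI simp: tendsto_minus_cancel_left)
  ultimately have Y: "lim_neg n - lim_pos n = infsum y UNIV" by simp
  have pos: "0 < infsum x UNIV" "0 < infsum y UNIV" using orbit_infsum_pos[OF orb] .
  define q where "q = 1 - 6 * \<kappa>"
  have q: "0 < q" "q \<le> (1 - 3 * \<kappa>)\<^sup>2"
    using kappa_less by (auto simp: q_def power2_eq_square algebra_simps)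
  have "q * infsum x UNIV \<le> infsum y UNIV" "q * infsum y UNIV \<le> infsum x UNIV"
    using orbit_infsum_le[OF orb] orbit_infsum_ge[OF orb] mult_right_mono[OF q(2)] pos
    by (meson less_imp_le order_trans)+
  then have r: "q \<le> r" "q * r \<le> 1"
    unfolding r_def X Y using pos by (simp_all add: field_simps)
  \<comment> \<open>The product is \<open>1 + 6 * \<kappa> * (1 - 12 * \<kappa>)\<close>; this is
    where 12 and the threshold \<open>1/12\<close> fit together.\<close>
  have "1 \<le> q * (1 + 12 * \<kappa>)"
  proof -
    have "0 \<le> \<kappa> * (1 - 12 * \<kappa>)" using kappa_pos kappa_less by simp
    then show ?thesis by (simp add: q_def algebra_simps)
  qed
  then have "q * r \<le> q * (1 + 12 * \<kappa>)" using r(2) by linarith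
  then have "r \<le> 1 + 12 * \<kappa>" using q(1) by simp
  then show ?thesis using r(1) kappa_pos by (simp add: q_def abs_le_iff)
qed

lemma lambda_max_bounds: "\<bar>lambda_max \<kappa> \<rho> - 1\<bar> \<le> ereal (12 * \<kappa>)"
proof -
  define r where "r = (\<lambda>(a :: int \<Rightarrow> real, b :: int \<Rightarrow> real, m, n). (lim_neg n - lim_pos n) / (lim_pos m - lim_neg m))"
  have sup: "lambda_max \<kappa> \<rho> = (SUP E \<in> ABMN \<kappa> \<rho>. ereal (r E))"
    unfolding lambda_max_def r_def by (simp add: case_prod_unfold)
  have r: "\<bar>r E - 1\<bar> \<le> 12 * \<kappa>" if "E \<in> ABMN \<kappa> \<rho>" for E
    using ABMN_ratio_bounds that by (cases E) (auto simp: r_def)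
  have "lambda_max \<kappa> \<rho> \<le> ereal (1 + 12 * \<kappa>)"
    unfolding sup using r by (intro SUP_least) fastforce
  moreover obtain E where "E \<in> ABMN \<kappa> \<rho>" using ABMN_nonempty by blast
  then have "ereal (1 - 12 * \<kappa>) \<le> lambda_max \<kappa> \<rho>"
    unfolding sup using r[of E] by (intro SUP_upper2[of E]) auto
  \<comment> \<open>The finite bounds on both sides exclude infinite values of the supremum.\<close>
  ultimately obtain l where "lambda_max \<kappa> \<rho> = ereal l" "1 - 12 * \<kappa> \<le> l" "l \<le> 1 + 12 * \<kappa>"
    by (cases "lambda_max \<kappa> \<rho>") auto
  then show ?thesis by (simp add: one_ereal_def abs_le_iff)
qed

end

theorem theorem1p23:
  shows "\<exists>C \<eta> \<kappa>\<^sub>0 :: real. C > 0 \<and> 0 < \<eta> \<and> \<eta> < 1 \<and> 0 < \<kappa>\<^sub>0 \<and> \<kappa>\<^sub>0 < 1 \<and>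
    (\<forall>\<kappa> \<rho> :: real. 0 < \<kappa> \<and> \<kappa> < \<kappa>\<^sub>0 \<and> 0 < \<rho> \<and> \<rho> \<le> 1 \<longrightarrow>
       \<bar>lambda_max \<kappa> \<rho> - 1\<bar> \<le> ereal (C * \<kappa> powr \<eta>))"
proof -
  \<comment> \<open>The exponent must be below 1, so the linear bound is weakened to a square root,
    using \<open>\<kappa> < 1\<close>.\<close>
  have "\<bar>lambda_max \<kappa> \<rho> - 1\<bar> \<le> ereal (12 * \<kappa> powr (1 / 2))"
    if "0 < \<kappa>" "\<kappa> < 1 / 12" "0 < \<rho>" "\<rho> \<le> 1" for \<kappa> \<rho> :: real
  proof -
    have "\<kappa> \<le> \<kappa> powr (1 / 2)"
      using that powr_mono'[of "1 / 2" 1 \<kappa>] by simp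
    then have "ereal (12 * \<kappa>) \<le> ereal (12 * \<kappa> powr (1 / 2))" by simp
    then show ?thesis
      using small_noise.lambda_max_bounds[of \<kappa> \<rho>] that by (auto simp: small_noise_def intro: order_trans)
  qed
  then show ?thesis
    by (intro exI[of _ 12] exI[of _ "1 / 2"] exI[of _ "1 / 12"]) auto
qed

end
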